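(* Let $E=\{\Phi(\omega):\omega\in\Omega\}\subset A_0$. Then $E$, ordered by leading monomials, is a sequence $$y_{3,1}=a_0(x^2x),\quad y_{4,1},\dots,y_{4,3c_3-3c_2},\quad y_{5,1},\dots,y_{5,3c_4-3c_3},\ \dots$$ of elements of $A_0$ (with $y_{n,i}$ homogeneous of degree $n$) that freely generates the (unital, non-associative) algebra $A_0$.
   Context: $K$ is a field of characteristic $0$. $M=M(x)$ is the free magma (without unit) on one generator $x$, i.e. the set of planar binary rooted trees with at least one leaf; $\deg$ is the number of leaves. $A=K\{x\}$ is the free unital, not necessarily associative, $K$-algebra on $x$, with basis $M\cup\{1\}$, graded by $\deg$. $D=\frac{d}{dx}$ is the $K$-linear derivation with $D(x)=1$, and $A_0=\ker D$ is the algebra of constants. $L(f)=x\cdot f$, $x^j.f=L^j(f)$, $x^j=L^j(1)$. Every $f\in A$ has a unique (finite) Taylor expansion $f=\sum_{j\ge 0}x^j.a_j(f)$ with $a_j(f)\in A_0$; one sets $\Phi(f)=a_0(f)$. $\Gamma=M-(xM\cup\{x\})$, a sub-magma of $M$, and $$\Omega=\{s_1\cdot s_2:\ s_1\in M-\{x\},\ s_2\in M,\ \text{such that } s_1\notin\Gamma\text{ or } s_2\notin\Gamma\}.$$ $c_n=\frac{(2(n-1))!}{n!(n-1)!}$ ($n\ge 1$) are the Catalan numbers. Order on $M$: first by increasing degree; for $s=s_1s_2$, $t=t_1t_2$ of the same degree, $s<t$ if $s_1<t_1$, or if $s_1=t_1$ and $s_2<t_2$. The leading monomial of a homogeneous polynomial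 is its maximal monomial. *)

theory Defs
  imports Complex_Main "HOL-Library.Poly_Mapping"
begin

section \<open>The free magma\<close>

datatype (gens: 'v) mag = Gen 'v | Br "'v mag" "'v mag"

primrec deg :: "'v mag \<Rightarrow> nat" where
  "deg (Gen v) = 1"
| "deg (Br s t) = deg s + deg t"

lemma deg_pos: "0 < deg s"
  by (induction s) auto

text \<open>Monomials are compared by degree first, then lexicographically. On the free magma
  with one generator the clause for two generators is vacuous.\<close>

fun mag_less :: "'v::linorder mag \<Rightarrow> 'v mag \<Rightarrow> bool" where
  "mag_less (Gen v) (Gen w) \<longleftrightarrow> v < w"
| "mag_less (Br s1 s2) (Br t1 t2) \<longleftrightarrow>
     deg (Br s1 s2) < deg (Br t1 t2) \<or>
     deg (Br s1 s2) = deg (Br t1 t2) \<and> (mag_less s1 t1 \<or> s1 = t1 \<and> mag_less s2 t2)"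
| "mag_less s t \<longleftrightarrow> deg s < deg t"

lemma mag_less_irrefl: "\<not> mag_less s s"
  by (induction s) auto

lemma mag_less_deg: "mag_less s t \<Longrightarrow> deg s \<le> deg t"
  by (induction s t rule: mag_less.induct) auto

lemma mag_less_trans: "mag_less s t \<Longrightarrow> mag_less t u \<Longrightarrow> mag_less s u"
proof (induction s arbitrary: t u)
  case (Gen v)
  then show ?case
    using mag_less_deg[of "Gen v" t] mag_less_deg[of t u]
      deg_pos add_pos_pos
    by (cases t; cases u) (auto dest!: mag_less_deg intro: less_le_trans)
next
  case (Br s1 s2)
  have "\<not> mag_less (Br s1 s2) (Gen w)" for w :: 'a
    using deg_pos[of s1] deg_pos[of s2] by simp
  with Br.prems obtain t1 t2 where t: "t = Br t1 t2" by (cases t) auto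
  have "\<not> mag_less (Br t1 t2) (Gen w)" for w :: 'a
    using deg_pos[of t1] deg_pos[of t2] by simp
  with Br.prems t obtain u1 u2 where u: "u = Br u1 u2" by (cases u) auto
  show ?case using Br.prems Br.IH unfolding t u by (auto; blast)
qed

lemma mag_less_total: "mag_less s t \<or> s = t \<or> mag_less t s"
proof (induction s arbitrary: t)
  case (Gen v)
  show ?case
  proof (cases t)
    case (Br t1 t2)
    then show ?thesis using deg_pos[of t1] deg_pos[of t2] by simp
  qed auto
next
  case (Br s1 s2)
  show ?case
  proof (cases t)
    case (Gen v)
    then show ?thesis using deg_pos[of s1] deg_pos[of s2] by simp
  next
    case t: (Br t1 t2)
    show ?thesis using Br.IH[of t1] Br.IH(2)[of t2] unfolding t by auto
  qed
qed

instantiation mag :: (linorder) linorder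
begin

definition "s < t \<longleftrightarrow> mag_less s t" for s t :: "'a mag"

definition "s \<le> t \<longleftrightarrow> s = t \<or> mag_less s t" for s t :: "'a mag"

instance
  by standard
    (use mag_less_irrefl mag_less_trans mag_less_total in
      \<open>unfold less_mag_def less_eq_mag_def, blast+\<close>)

end


section \<open>The free unital non-associative algebra\<close>

text \<open>A basis is given by the free magma with a unit adjoined: \<^term>\<open>None\<close> is the unit and
  \<^term>\<open>Some s\<close> is the monomial \<open>s\<close>. The product of \<^theory>\<open>HOL-Library.Poly_Mapping\<close> cannot be
  used, as it is only available for monomials forming an associative monoid.\<close>

type_synonym ('v, 'k) nalg = "'v mag option \<Rightarrow>\<^sub>0 'k"

fun mon_mult :: "'v mag option \<Rightarrow> 'v mag option \<Rightarrow> 'v mag option" where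
  "mon_mult None t = t"
| "mon_mult s None = s"
| "mon_mult (Some s) (Some t) = Some (Br s t)"

fun mon_deg :: "'v mag option \<Rightarrow> nat" where
  "mon_deg None = 0"
| "mon_deg (Some s) = deg s"

definition scale :: "'k::semiring_0 \<Rightarrow> ('m \<Rightarrow>\<^sub>0 'k) \<Rightarrow> ('m \<Rightarrow>\<^sub>0 'k)" where
  "scale c = Poly_Mapping.map ((*) c)"

definition lin_ext :: "('m \<Rightarrow> ('n \<Rightarrow>\<^sub>0 'k)) \<Rightarrow> ('m \<Rightarrow>\<^sub>0 'k) \<Rightarrow> ('n \<Rightarrow>\<^sub>0 'k::semiring_0)" where
  "lin_ext g f = (\<Sum>m\<in>Poly_Mapping.keys f. scale (Poly_Mapping.lookup f m) (g m))"

definition nmult :: "('v, 'k::semiring_1) nalg \<Rightarrow> ('v, 'k) nalg \<Rightarrow> ('v, 'k) nalg"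
    (infixl \<open>\<odot>\<close> 70) where
  "f \<odot> g = lin_ext (\<lambda>s. lin_ext (\<lambda>t. Poly_Mapping.single (mon_mult s t) 1) g) f"

definition nalg_one :: "('v, 'k::semiring_1) nalg" where
  "nalg_one = Poly_Mapping.single None 1"

definition var :: "'v \<Rightarrow> ('v, 'k::semiring_1) nalg" where
  "var v = Poly_Mapping.single (Some (Gen v)) 1"

definition homogeneous :: "nat \<Rightarrow> ('v, 'k::zero) nalg \<Rightarrow> bool" where
  "homogeneous n f \<longleftrightarrow> (\<forall>m\<in>Poly_Mapping.keys f. mon_deg m = n)"

text \<open>Only meaningful for non-zero homogeneous elements of positive degree, where the monomial
  \<^term>\<open>None\<close> does not occur.\<close>

definition leading_monomial :: "('v::linorder, 'k::zero) nalg \<Rightarrow> 'v mag" where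
  "leading_monomial f = Max {s. Some s \<in> Poly_Mapping.keys f}"

subsection \<open>Free generation\<close>

text \<open>The homomorphism of unital algebras with \<open>var v \<mapsto> y v\<close>.\<close>

primrec mag_eval :: "('w \<Rightarrow> ('v, 'k::semiring_1) nalg) \<Rightarrow> 'w mag \<Rightarrow> ('v, 'k) nalg" where
  "mag_eval y (Gen v) = y v"
| "mag_eval y (Br s t) = mag_eval y s \<odot> mag_eval y t"

definition subst :: "('w \<Rightarrow> ('v, 'k::semiring_1) nalg) \<Rightarrow> ('w, 'k) nalg \<Rightarrow> ('v, 'k) nalg" where
  "subst y = lin_ext (case_option nalg_one (mag_eval y))"

definition free_nalg_on :: "'w set \<Rightarrow> ('w, 'k::zero) nalg set" where
  "free_nalg_on I = {f. \<forall>s. Some s \<in> Poly_Mapping.keys f \<longrightarrow> gens s \<subseteq> I}"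

text \<open>The canonical homomorphism from the free algebra on the index set \<open>I\<close> is an
  isomorphism onto \<open>B\<close>.\<close>

definition freely_generates ::
    "'w set \<Rightarrow> ('w \<Rightarrow> ('v, 'k::semiring_1) nalg) \<Rightarrow> ('v, 'k) nalg set \<Rightarrow> bool" where
  "freely_generates I y B \<longleftrightarrow> bij_betw (subst y) (free_nalg_on I) B"


section \<open>One generator\<close>

type_synonym M = "unit mag"
type_synonym 'k A = "(unit, 'k) nalg"

abbreviation X :: M where "X \<equiv> Gen ()"

abbreviation mag_mono :: "M \<Rightarrow> 'k::semiring_1 A" where
  "mag_mono s \<equiv> Poly_Mapping.single (Some s) 1"

abbreviation xA :: "'k::semiring_1 A" where "xA \<equiv> var ()"

primrec D_mag :: "M \<Rightarrow> 'k::semiring_1 A" where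
  "D_mag (Gen _) = nalg_one"
| "D_mag (Br s t) = D_mag s \<odot> mag_mono t + mag_mono s \<odot> D_mag t"

definition D :: "'k::semiring_1 A \<Rightarrow> 'k A" where
  "D = lin_ext (case_option 0 D_mag)"

definition constants :: "'k::semiring_1 A set" where
  "constants = {f. D f = 0}"

definition L :: "'k::semiring_1 A \<Rightarrow> 'k A" where
  "L f = xA \<odot> f"

definition xpow :: "nat \<Rightarrow> 'k::semiring_1 A" where
  "xpow j = (L ^^ j) nalg_one"

definition is_taylor :: "'k::semiring_1 A \<Rightarrow> (nat \<Rightarrow> 'k A) \<Rightarrow> bool" where
  "is_taylor f a \<longleftrightarrow> finite {j. a j \<noteq> 0} \<and> (\<forall>j. a j \<in> constants) \<and>
     f = (\<Sum>j | a j \<noteq> 0. (L ^^ j) (a j))"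

text \<open>In characteristic 0 the description below is well-defined by the theorem
  \<open>ex1_taylor\<close> at the end of this theory.\<close>

definition taylor_coeff :: "nat \<Rightarrow> 'k::semiring_1 A \<Rightarrow> 'k A" where
  "taylor_coeff j f = (THE a. is_taylor f a) j"

definition \<Phi> :: "'k::semiring_1 A \<Rightarrow> 'k A" where
  "\<Phi> f = taylor_coeff 0 f"

definition \<Gamma> :: "M set" where
  "\<Gamma> = UNIV - (range (Br X) \<union> {X})"

definition \<Omega> :: "M set" where
  "\<Omega> = {Br s1 s2 | s1 s2. s1 \<noteq> X \<and> (s1 \<notin> \<Gamma> \<or> s2 \<notin> \<Gamma>)}"

definition catalan :: "nat \<Rightarrow> nat" where
  "catalan n = fact (2 * (n - 1)) div (fact n * fact (n - 1))"

text \<open>The index pairs \<open>(n, i)\<close> of the sequence \<open>y\<^bsub>3,1\<^esub>, y\<^bsub>4,1\<^esub>, \<dots>\<close>; the degree 3 does not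
  follow the pattern of the higher degrees.\<close>

definition idx :: "(nat \<times> nat) set" where
  "idx = {(3, 1)} \<union>
     {(n, i). 4 \<le> n \<and> 1 \<le> i \<and> i \<le> 3 * catalan (n - 1) - 3 * catalan (n - 2)}"


section \<open>Basic facts\<close>

text \<open>The division in the definition of the Catalan numbers is exact.\<close>

lemma catalan_exact:
  assumes "1 \<le> n"
  shows "real (catalan n) = fact (2 * (n - 1)) / (fact n * fact (n - 1))"
proof -
  obtain m where n: "n = Suc m" using assms by (cases n) auto
  define q :: nat where "q = (2 * m) choose m"
  define r :: nat where "r = (2 * m) choose (Suc m)"
  have q: "fact m * fact m * q = fact (2 * m)"
    using binomial_fact_lemma[of m "2 * m"] by (simp add: q_def)
  have "Suc m * r = m * q"
    using binomial_absorb_comp[of "2 * m" m] binomial_absorption[of m "2 * m"]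
      Suc_times_binomial_add[of m "m - 1"] 
    unfolding q_def r_def
    by (cases m) (auto simp: binomial_symmetric[of "Suc m"] algebra_simps)
  then have "Suc m * (q - r) = q"
    by (simp add: diff_mult_distrib2)
  then have "fact (2 * m) = fact n * fact m * (q - r)"
    using q unfolding n by (metis fact_Suc mult.assoc mult.commute of_nat_id)
  then have "(fact n * fact (n - 1) :: nat) dvd fact (2 * (n - 1))"
    unfolding n by simp
  then show ?thesis
    unfolding catalan_def by (simp add: real_of_nat_div)
qed

lemma lookup_scale [simp]: "Poly_Mapping.lookup (scale c f) m = c * Poly_Mapping.lookup f m"
  for c :: "'k::semiring_0"
  by (simp add: scale_def Poly_Mapping.map.rep_eq when_def)

lemma scale_add: "scale c (f + g) = scale c f + scale c g"
  by (rule poly_mapping_eqI) (simp add: lookup_add distrib_left)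

lemma scale_add_left: "scale (c + d) f = scale c f + scale d f"
  by (rule poly_mapping_eqI) (simp add: lookup_add distrib_right)

lemma scale_scale: "scale c (scale d f) = scale (c * d) f"
  by (rule poly_mapping_eqI) (simp add: mult.assoc)

lemma scale_zero [simp]: "scale 0 f = 0" "scale c 0 = 0"
  by (rule poly_mapping_eqI; simp)+

lemma scale_one [simp]: "scale (1::'k::semiring_1) f = f"
  by (rule poly_mapping_eqI) simp

lemma scale_sum: "scale c (\<Sum>i\<in>S. h i) = (\<Sum>i\<in>S. scale c (h i))"
  by (induction S rule: infinite_finite_induct) (auto simp: scale_add)

lemma lin_ext_superset:
  assumes "finite S" "Poly_Mapping.keys f \<subseteq> S"
  shows "lin_ext g f = (\<Sum>m\<in>S. scale (Poly_Mapping.lookup f m) (g m))"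
  unfolding lin_ext_def using assms by (intro sum.mono_neutral_left) (auto simp: in_keys_iff)

lemma lin_ext_add: "lin_ext g (f + h) = lin_ext g f + lin_ext g h"
proof -
  let ?S = "Poly_Mapping.keys f \<union> Poly_Mapping.keys h"
  have "Poly_Mapping.keys (f + h) \<subseteq> ?S" by (rule Poly_Mapping.keys_add)
  then show ?thesis
    by (simp add: lin_ext_superset[of ?S] lookup_add scale_add_left sum.distrib)
qed

lemma lin_ext_scale: "lin_ext g (scale c f) = scale c (lin_ext g f)"
proof -
  have "Poly_Mapping.keys (scale c f) \<subseteq> Poly_Mapping.keys f"
    by (auto simp: in_keys_iff)
  then show ?thesis
    by (simp add: lin_ext_superset[of "Poly_Mapping.keys f"] scale_sum scale_scale)
qed

lemma lin_ext_zero [simp]: "lin_ext g 0 = 0"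
  by (simp add: lin_ext_def)

lemma lin_ext_single [simp]: "lin_ext g (Poly_Mapping.single m c) = scale c (g m)"
  by (simp add: lin_ext_def)

lemma nmult_add_left: "(f + g) \<odot> h = f \<odot> h + g \<odot> h"
  by (simp add: nmult_def lin_ext_add)

lemma nmult_scale_left: "scale c f \<odot> h = scale c (f \<odot> h)"
  by (simp add: nmult_def lin_ext_scale)

lemma nmult_add_right: "h \<odot> (f + g) = h \<odot> f + h \<odot> g"
  unfolding nmult_def lin_ext_add by (simp add: lin_ext_def scale_add sum.distrib)

lemma nmult_scale_right: "h \<odot> scale c f = scale c (h \<odot> f)"
  for c :: "'k::comm_semiring_1"
  unfolding nmult_def lin_ext_scale
  by (simp add: lin_ext_def[of _ h] scale_sum scale_scale mult.commute)

lemma nmult_zero [simp]: "0 \<odot> f = 0" "f \<odot> 0 = 0"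
  by (simp_all add: nmult_def lin_ext_def)

lemma nmult_mono:
  "Poly_Mapping.single s 1 \<odot> Poly_Mapping.single t 1 = Poly_Mapping.single (mon_mult s t) 1"
  by (simp add: nmult_def)

lemma nalg_induct [case_names zero add scale mono]:
  fixes f :: "'m \<Rightarrow>\<^sub>0 'k::semiring_1"
  assumes "P 0" "\<And>f g. P f \<Longrightarrow> P g \<Longrightarrow> P (f + g)" "\<And>c f. P f \<Longrightarrow> P (scale c f)"
    and "\<And>m. P (Poly_Mapping.single m 1)"
  shows "P f"
proof -
  have "f = lin_ext (\<lambda>m. Poly_Mapping.single m 1) f"
    by (rule poly_mapping_eqI)
      (simp add: lin_ext_def lookup_sum lookup_single when_def in_keys_iff
        if_distrib[of "\<lambda>u. _ * u"] cong: if_cong)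
  moreover have "P (\<Sum>m\<in>S. scale (c m) (Poly_Mapping.single m 1))" for S and c :: "'m \<Rightarrow> 'k"
    using assms by (induction S rule: infinite_finite_induct) auto
  ultimately show ?thesis unfolding lin_ext_def by metis
qed

lemma nalg_one_nmult [simp]: "nalg_one \<odot> f = f"
  by (induction f rule: nalg_induct)
    (simp_all add: nmult_add_right nalg_one_def nmult_mono, simp add: nmult_def lin_ext_scale)

lemma nmult_nalg_one [simp]: "f \<odot> nalg_one = f"
proof (induction f rule: nalg_induct)
  case (mono m)
  show ?case by (cases m) (simp_all add: nalg_one_def nmult_mono)
qed (simp_all add: nmult_add_left nmult_scale_left)

text \<open>\<^term>\<open>D\<close> is a \<open>K\<close>-linear derivation with \<open>D x = 1\<close>, and \<^term>\<open>subst y\<close> is a homomorphism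
  of unital algebras.\<close>

lemma D_add: "D (f + g) = D f + D g"
  by (simp add: D_def lin_ext_add)

lemma D_scale: "D (scale c f) = scale c (D f)"
  by (simp add: D_def lin_ext_scale)

lemma D_x: "D xA = nalg_one"
  by (simp add: D_def var_def)

lemma D_nmult: "D (f \<odot> g) = D f \<odot> g + f \<odot> D g"
  for f g :: "'k::comm_semiring_1 A"
proof (induction f rule: nalg_induct)
  case (mono m)
  show ?case
  proof (induction g rule: nalg_induct)
    case m': (mono m')
    have [simp]: "Poly_Mapping.single None 1 \<odot> h = h" "h \<odot> Poly_Mapping.single None 1 = h"
      for h :: "'k A"
      using nalg_one_nmult[of h] nmult_nalg_one[of h] by (simp_all add: nalg_one_def)
    show ?case
      by (cases m; cases m') (simp_all add: nmult_mono D_def)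
  qed (simp_all add: nmult_add_right nmult_scale_right D_add D_scale scale_add add_ac,
       simp add: D_def)
qed (simp_all add: nmult_add_left nmult_scale_left D_add D_scale scale_add add_ac,
     simp add: D_def)

lemma subst_add: "subst y (f + g) = subst y f + subst y g"
  by (simp add: subst_def lin_ext_add)

lemma subst_scale: "subst y (scale c f) = scale c (subst y f)"
  by (simp add: subst_def lin_ext_scale)

lemma subst_nalg_one: "subst y nalg_one = nalg_one"
  by (simp add: subst_def nalg_one_def)

lemma subst_var: "subst y (var v) = y v"
  by (simp add: subst_def var_def)

lemma subst_nmult: "subst y (f \<odot> g) = subst y f \<odot> subst y g"
  for f g :: "('w, 'k::comm_semiring_1) nalg"
proof (induction f rule: nalg_induct)
  case (mono m)
  show ?case
  proof (induction g rule: nalg_induct)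
    case m': (mono m')
    show ?case
      by (cases m; cases m') (simp_all add: nmult_mono subst_def)
  qed (simp_all add: nmult_add_right nmult_scale_right subst_add subst_scale,
       simp add: subst_def)
qed (simp_all add: nmult_add_left nmult_scale_left subst_add subst_scale,
     simp add: subst_def)

subsection \<open>Existence and uniqueness of Taylor expansions\<close>

lemma D_zero [simp]: "D 0 = 0"
  by (simp add: D_def)

lemma D_pow_add: "(D ^^ n) (f + g) = (D ^^ n) f + (D ^^ n) g"
  by (induction n) (simp_all add: D_add)

lemma D_pow_scale: "(D ^^ n) (scale c f) = scale c ((D ^^ n) f)"
  by (induction n) (simp_all add: D_scale)

lemma D_pow_zero [simp]: "(D ^^ n) 0 = 0"
  by (induction n) simp_all

lemma D_pow_mono: "(D ^^ m) f = 0 \<Longrightarrow> m \<le> n \<Longrightarrow> (D ^^ n) f = 0"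
  by (metis D_pow_zero funpow_add comp_apply le_add_diff_inverse2)

lemma D_pow_nmult:
  fixes f g :: "'k::comm_semiring_1 A"
  assumes "(D ^^ a) f = 0" "(D ^^ b) g = 0"
  shows "(D ^^ (a + b)) (f \<odot> g) = 0"
  using assms
proof (induction "a + b" arbitrary: a b f g)
  case 0
  then show ?case by simp
next
  case (Suc n)
  show ?case
  proof (cases "a = 0 \<or> b = 0")
    case True
    then show ?thesis using Suc.prems by auto
  next
    case False
    then obtain a' b' where ab: "a = Suc a'" "b = Suc b'"
      by (metis not0_implies_Suc)
    have n: "n = a' + b" "n = a + b'" using Suc.hyps(2) ab by auto
    have "(D ^^ n) (D f \<odot> g) = 0"
      unfolding n(1) by (rule Suc.hyps(1)) (use n Suc.prems ab in \<open>auto simp: funpow_swap1\<close>)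
    moreover have "(D ^^ n) (f \<odot> D g) = 0"
      unfolding n(2) by (rule Suc.hyps(1)) (use n Suc.prems ab in \<open>auto simp: funpow_swap1\<close>)
    ultimately show ?thesis
      unfolding Suc.hyps(2)[symmetric]
      by (simp add: funpow_Suc_right D_nmult D_pow_add del: funpow.simps)
  qed
qed

lemma D_locally_nilpotent: "\<exists>n. (D ^^ n) f = 0"
  for f :: "'k::comm_semiring_1 A"
proof (induction f rule: nalg_induct)
  case (add f g)
  then obtain m n where "(D ^^ m) f = 0" "(D ^^ n) g = 0" by auto
  then have "(D ^^ (max m n)) (f + g) = 0"
    using D_pow_mono[of m f "max m n"] D_pow_mono[of n g "max m n"] by (simp add: D_pow_add)
  then show ?case by blast
next
  case (mono m)
  show ?case
  proof (cases m)
    case None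
    then have "(D ^^ 1) (Poly_Mapping.single m 1 :: 'k A) = 0" by (simp add: D_def)
    then show ?thesis by blast
  next
    case (Some s)
    have "\<exists>n. (D ^^ n) (mag_mono s :: 'k A) = 0"
    proof (induction s)
      case (Gen v)
      have "(D ^^ 2) (mag_mono (Gen v) :: 'k A) = 0"
        by (simp add: D_def nalg_one_def numeral_2_eq_2)
      then show ?case by blast
    next
      case (Br s t)
      then obtain a b where "(D ^^ a) (mag_mono s :: 'k A) = 0" "(D ^^ b) (mag_mono t :: 'k A) = 0"
        by auto
      from D_pow_nmult[OF this] show ?case by (auto simp: nmult_mono)
    qed
    then show ?thesis using Some by simp
  qed
next
  case (scale c f)
  then obtain n where "(D ^^ n) f = 0" by auto
  then have "(D ^^ n) (scale c f) = 0" by (simp add: D_pow_scale)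
  then show ?case by blast
qed (rule exI[of _ 0], simp)

lemma L_zero [simp]: "L 0 = 0"
  by (simp add: L_def)

lemma L_pow_zero [simp]: "(L ^^ n) 0 = 0"
  by (induction n) simp_all

lemma L_pow_add: "(L ^^ n) (f + g) = (L ^^ n) f + (L ^^ n) g"
  by (induction n) (simp_all add: L_def nmult_add_right)

lemma L_pow_scale: "(L ^^ n) (scale c f) = scale c ((L ^^ n) f)"
  for c :: "'k::comm_semiring_1"
  by (induction n) (simp_all add: L_def nmult_scale_right)

lemma D_L_pow:
  fixes a :: "'k::comm_semiring_1 A"
  assumes "a \<in> constants"
  shows "D ((L ^^ n) a) = (if n = 0 then 0 else scale (of_nat n) ((L ^^ (n - 1)) a))"
proof (induction n)
  case 0
  then show ?case using assms by (simp add: constants_def)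
next
  case (Suc n)
  have "D ((L ^^ Suc n) a) = (L ^^ n) a + L (D ((L ^^ n) a))"
    by (simp add: L_def D_nmult D_x)
  also have "\<dots> = scale (of_nat (Suc n)) ((L ^^ n) a)"
    unfolding Suc by (cases n) (simp_all add: scale_add_left L_pow_scale L_def nmult_scale_right nmult_add_right)
  finally show ?case by simp
qed

lemma D_sum: "D (\<Sum>i\<in>S. h i) = (\<Sum>i\<in>S. D (h i))"
  by (induction S rule: infinite_finite_induct) (auto simp: D_add)

lemma is_taylor_bound:
  fixes f :: "'k::comm_semiring_1 A"
  shows "is_taylor f a \<longleftrightarrow>
    (\<forall>j. a j \<in> constants) \<and> (\<exists>N. (\<forall>j\<ge>N. a j = 0) \<and> f = (\<Sum>j<N. (L ^^ j) (a j)))"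
proof -
  have bd: "{j. a j \<noteq> 0} \<subseteq> {..<N}" if "\<forall>j\<ge>N. a j = 0" for N
  proof
    fix j assume "j \<in> {j. a j \<noteq> 0}"
    then show "j \<in> {..<N}" using that by (cases "N \<le> j") auto
  qed
  have *: "(\<Sum>j | a j \<noteq> 0. (L ^^ j) (a j)) = (\<Sum>j<N. (L ^^ j) (a j))" if "\<forall>j\<ge>N. a j = 0" for N
    by (rule sum.mono_neutral_left[OF _ bd[OF that]]) simp_all
  have fin: "\<exists>N. \<forall>j\<ge>N. a j = 0" if "finite {j. a j \<noteq> 0}"
  proof -
    from that obtain N where N: "\<forall>j\<in>{j. a j \<noteq> 0}. j < N"
      using finite_nat_set_iff_bounded by blast
    have "a j = 0" if "j \<ge> N" for j using N that by (cases "a j = 0") auto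
    then show ?thesis by blast
  qed
  have fin': "finite {j. a j \<noteq> 0}" if "\<forall>j\<ge>N. a j = 0" for N
    using finite_subset[OF bd[OF that]] by simp
  show ?thesis
  proof
    assume t: "is_taylor f a"
    then obtain N where N: "\<forall>j\<ge>N. a j = 0" using fin unfolding is_taylor_def by blast
    have "f = (\<Sum>j<N. (L ^^ j) (a j))" using t *[OF N] unfolding is_taylor_def by simp
    with t N show "(\<forall>j. a j \<in> constants) \<and>
        (\<exists>N. (\<forall>j\<ge>N. a j = 0) \<and> f = (\<Sum>j<N. (L ^^ j) (a j)))"
      unfolding is_taylor_def by blast
  next
    assume t: "(\<forall>j. a j \<in> constants) \<and>
        (\<exists>N. (\<forall>j\<ge>N. a j = 0) \<and> f = (\<Sum>j<N. (L ^^ j) (a j)))"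
    then obtain N where N: "\<forall>j\<ge>N. a j = 0" "f = (\<Sum>j<N. (L ^^ j) (a j))" by blast
    show "is_taylor f a" using t fin'[OF N(1)] *[OF N(1)] N(2) unfolding is_taylor_def by simp
  qed
qed

lemma D_taylor_sum:
  fixes a :: "nat \<Rightarrow> 'k::comm_semiring_1 A"
  assumes "\<And>j. a j \<in> constants"
  shows "D (\<Sum>j<Suc N. (L ^^ j) (a j)) = (\<Sum>j<N. (L ^^ j) (scale (of_nat (Suc j)) (a (Suc j))))"
  unfolding sum.lessThan_Suc_shift D_add D_sum D_L_pow[OF assms]
  by (simp add: L_pow_scale del: of_nat_Suc)

lemma scale_constants: "a \<in> constants \<Longrightarrow> scale c a \<in> constants"
  by (simp add: constants_def D_scale)

lemma taylor_zero:
  fixes a :: "nat \<Rightarrow> 'k::field_char_0 A"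
  assumes "\<And>j. a j \<in> constants" "(\<Sum>j<N. (L ^^ j) (a j)) = 0" "j < N"
  shows "a j = 0"
  using assms
proof (induction N arbitrary: a j)
  case (Suc N)
  have "(\<Sum>j<N. (L ^^ j) (scale (of_nat (Suc j)) (a (Suc j)))) = 0"
    using D_taylor_sum[of a N, OF Suc.prems(1)] Suc.prems(2) by simp
  then have *: "scale (of_nat (Suc i)) (a (Suc i)) = 0" if "i < N" for i
    by (intro Suc.IH[of "\<lambda>j. scale (of_nat (Suc j)) (a (Suc j))"])
      (use that Suc.prems(1) scale_constants in auto)
  have suc: "a (Suc i) = 0" if "i < N" for i
  proof -
    have "a (Suc i) = scale (inverse (of_nat (Suc i))) (scale (of_nat (Suc i)) (a (Suc i)))"
      unfolding scale_scale by (simp del: of_nat_Suc)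
    then show ?thesis unfolding *[OF that] by simp
  qed
  have "(\<Sum>j<Suc N. (L ^^ j) (a j)) = a 0"
    unfolding sum.lessThan_Suc_shift by (simp add: suc del: funpow.simps(2))
  then show ?case using Suc.prems suc by (cases j) auto
qed simp

theorem ex1_taylor: "\<exists>!a. is_taylor f a"
  for f :: "'k::field_char_0 A"
proof (rule ex_ex1I)
  obtain n where "(D ^^ n) f = 0" using D_locally_nilpotent by blast
  then show "\<exists>a. is_taylor f a"
  proof (induction n arbitrary: f)
    case 0
    then have "is_taylor f (\<lambda>_. 0)" by (simp add: is_taylor_def constants_def)
    then show ?case by blast
  next
    case (Suc n)
    have "(D ^^ n) (D f) = 0" using Suc.prems by (simp add: funpow_swap1)
    from Suc.IH[OF this] obtain a N where a: "\<And>j. a j \<in> constants" "\<And>j. j \<ge> N \<Longrightarrow> a j = 0"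
      and Df: "D f = (\<Sum>j<N. (L ^^ j) (a j))"
      unfolding is_taylor_bound by auto
    define b where "b = case_nat 0 (\<lambda>j. scale (inverse (of_nat (Suc j))) (a j))"
    define r where "r = f - (\<Sum>j<Suc N. (L ^^ j) (b j))"
    define c where "c = case_nat r (\<lambda>j. b (Suc j))"
    have b: "b j \<in> constants" for j
      using a(1) by (cases j) (auto simp: b_def scale_constants, simp add: constants_def)
    have Db: "D (\<Sum>j<Suc N. (L ^^ j) (b j)) = D f"
      unfolding D_taylor_sum[OF b] Df unfolding b_def
      by (simp add: scale_scale del: of_nat_Suc sum.lessThan_Suc)
    have f: "f = r + (\<Sum>j<Suc N. (L ^^ j) (b j))" by (simp add: r_def)
    have "D f = D r + D f"
      using arg_cong[OF f, of D] unfolding D_add Db .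
    then have "r \<in> constants" by (simp add: constants_def)
    then have "c j \<in> constants" for j using b by (cases j) (auto simp: c_def)
    moreover have "c j = 0" if "j \<ge> Suc N" for j
      using that a(2) by (cases j) (auto simp: c_def b_def)
    moreover have "f = (\<Sum>j<Suc N. (L ^^ j) (c j))"
      using f unfolding sum.lessThan_Suc_shift
      by (simp add: c_def b_def del: funpow.simps(2))
    ultimately show ?case unfolding is_taylor_bound by blast
  qed
next
  fix a b
  assume ta: "is_taylor f a" and tb: "is_taylor f b"
  obtain M where a: "\<forall>j\<ge>M. a j = 0" "f = (\<Sum>j<M. (L ^^ j) (a j))"
    using ta unfolding is_taylor_bound by blast
  obtain N where b: "\<forall>j\<ge>N. b j = 0" "f = (\<Sum>j<N. (L ^^ j) (b j))"
    using tb unfolding is_taylor_bound by blast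
  define K where "K = max M N"
  have fa: "f = (\<Sum>j<K. (L ^^ j) (a j))"
    by (subst a(2), rule sum.mono_neutral_left) (use a(1) in \<open>auto simp: K_def\<close>)
  have fb: "f = (\<Sum>j<K. (L ^^ j) (b j))"
    by (subst b(2), rule sum.mono_neutral_left) (use b(1) in \<open>auto simp: K_def\<close>)
  define d where "d = (\<lambda>j. a j + scale (- 1) (b j))"
  have neg: "u + scale (- 1) v = u - v" for u v :: "'k A"
    by (rule poly_mapping_eqI) (simp add: lookup_add lookup_minus)
  have "(\<Sum>j<K. (L ^^ j) (d j)) = (\<Sum>j<K. (L ^^ j) (a j)) - (\<Sum>j<K. (L ^^ j) (b j))"
    unfolding d_def L_pow_add L_pow_scale sum_subtractf[symmetric] by (simp add: neg)
  then have z: "(\<Sum>j<K. (L ^^ j) (d j)) = 0"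
    unfolding fa[symmetric] fb[symmetric] by simp
  have "d j \<in> constants" for j
    using ta tb by (simp add: is_taylor_def constants_def d_def D_add D_scale)
  from taylor_zero[OF this z] have d: "d j = 0" if "j < K" for j using that by blast
  have "a j = b j" for j
  proof (cases "j < K")
    case True
    from d[OF this] show ?thesis unfolding d_def neg by simp
  next
    case False
    then show ?thesis using a(1) b(1) by (simp add: K_def)
  qed
  then show "a = b" by (rule ext)
qed

end

theory Submission
  imports Defs "HOL-Library.Option_ord" "HOL-Computational_Algebra.Formal_Power_Series"
begin

text \<open>The projection \<open>\<Phi>\<close> onto the constants has kernel \<open>L A\<close>, because
  \<open>A\<close> is the direct sum of \<open>constants\<close> and \<open>L A\<close> by the Taylor expansion
  (\<open>\<Phi>_decomposition\<close>, \<open>\<Phi>_eqI\<close>). The space \<open>L A\<close> is spanned by \<open>x\<close> and the monomials \<open>x t\<close>,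
  which are exactly the monomials outside \<open>\<Gamma>\<close>; so the constants are spanned by \<open>1\<close> and
  the \<open>\<Phi> s\<close> with \<open>s \<in> \<Gamma>\<close>. In a fixed degree at least 2 the monomials \<open>x t\<close> are smaller than
  those in \<open>\<Gamma>\<close>, since \<open>x\<close> is the least left factor, and \<open>\<Phi>\<close> preserves degrees. Therefore
  \<open>\<Phi> s\<close> has leading monomial \<open>s\<close> with coefficient 1 for every \<open>s \<in> \<Gamma>\<close> (\<open>monic_\<Phi>\<close>).

  Leading monomials multiply (\<open>monic_nmult\<close>), and \<open>\<Gamma>\<close> is a submagma of a free magma, hence
  free on its indecomposable elements (\<open>submagma_free\<close>); these form the set \<open>\<Omega>\<close> (\<open>\<Omega>_eq\<close>). So
  evaluating the magma monomials in new generators at the elements \<open>\<Phi> \<omega>\<close>, \<open>\<omega> \<in> \<Omega>\<close>, gives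
  constants whose leading monomials run through \<open>\<Gamma>\<close> without repetition. Distinct leading
  monomials make these values, together with \<open>1\<close>, linearly independent, and a
  well-founded induction along the order on \<open>\<Gamma>\<close> shows that they span the constants.

  What remains is to count \<open>\<Omega>\<close> in each degree. If \<open>C\<close>, \<open>g\<close>, \<open>o\<close> denote the generating functions
  by degree of all monomials, of \<open>\<Gamma>\<close> and of \<open>\<Omega>\<close>, then \<open>C = X + C\<^sup>2\<close>, \<open>C = X + X C + g\<close> and
  \<open>g = o + g\<^sup>2\<close>, from which \<open>o = 3 X C (1 - X) - 3 X\<^sup>2 + X\<^sup>3\<close> follows by elimination.\<close>

section \<open>Monomials and their order\<close>

lemma deg_neq_0 [simp]: "deg s \<noteq> 0"
  using deg_pos[of s] by simp

lemma finite_deg_le: "finite {s :: M. deg s \<le> n}"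
proof (induction n)
  case 0
  then show ?case by simp
next
  case (Suc n)
  have "s \<in> {X} \<union> case_prod Br ` ({s. deg s \<le> n} \<times> {s. deg s \<le> n})"
    if "deg s \<le> Suc n" for s :: M
  proof (cases s)
    case (Br s1 s2)
    then show ?thesis using that deg_pos[of s1] deg_pos[of s2] by auto
  qed simp
  then have "{s :: M. deg s \<le> Suc n}
      \<subseteq> {X} \<union> case_prod Br ` ({s. deg s \<le> n} \<times> {s. deg s \<le> n})" by blast
  then show ?case by (rule finite_subset) (use Suc in simp)
qed

lemma finite_deg_eq: "finite {s \<in> S. deg (s :: M) = n}"
  by (rule finite_subset[OF _ finite_deg_le[of n]]) auto

text \<open>The order is well-founded because it refines the comparison of degrees and there are
  only finitely many monomials of bounded degree; the number of smaller monomials serves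
  as the measure.\<close>

lemma M_less_induct [case_names less]:
  assumes "\<And>s :: M. (\<And>t. t < s \<Longrightarrow> P t) \<Longrightarrow> P s"
  shows "P s"
proof (induction s rule: measure_induct_rule[of "\<lambda>s. card {t. t < s}"])
  case (less s)
  have fin: "finite {t. t < s}"
    by (rule finite_subset[OF _ finite_deg_le[of "deg s"]])
      (auto simp: less_mag_def dest: mag_less_deg)
  have "card {u. u < t} < card {u. u < s}" if "t < s" for t
    by (rule psubset_card_mono[OF fin]) (use that in auto)
  then show ?case using assms less by blast
qed

lemma less_of_deg_less: "deg s < deg t \<Longrightarrow> s < t"
  using mag_less_total[of s t] mag_less_deg[of t s] by (auto simp: less_mag_def)

lemma Br_less_left: "s < s' \<Longrightarrow> Br s t < Br s' t"
  using mag_less_deg[of s s'] by (auto simp: less_mag_def)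

lemma Br_less_right: "t < t' \<Longrightarrow> Br s t < Br s t'"
  using mag_less_deg[of t t'] by (auto simp: less_mag_def)

lemma mon_mult_None [simp]: "mon_mult m None = m"
  by (cases m) auto

text \<open>Strict monotonicity in both factors includes the unit: \<open>None\<close> is the least element of
  \<open>M option\<close>, and a product with a proper monomial exceeds the other factor by its degree.\<close>

lemma mon_mult_less_left:
  assumes "m < m'"
  shows "mon_mult m n < mon_mult m' n"
proof -
  obtain s' where m': "m' = Some s'" using assms by (cases m') auto
  show ?thesis
  proof (cases m; cases n)
    fix t assume "m = None" "n = Some t"
    then show ?thesis using deg_pos[of s'] by (simp add: m' less_of_deg_less)
  qed (use assms in \<open>simp_all add: m' Br_less_left\<close>)
qed

lemma mon_mult_less_right:
  assumes "n < n'"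
  shows "mon_mult m n < mon_mult m n'"
proof -
  obtain t' where n': "n' = Some t'" using assms by (cases n') auto
  show ?thesis
  proof (cases m; cases n)
    fix s assume "m = Some s" "n = None"
    then show ?thesis using deg_pos[of t'] by (simp add: n' less_of_deg_less)
  qed (use assms in \<open>simp_all add: n' Br_less_right\<close>)
qed

lemma mon_deg_mult [simp]: "mon_deg (mon_mult m n) = mon_deg m + mon_deg n"
  by (cases m; cases n) auto

section \<open>Supports and leading terms\<close>

lemma keys_lin_ext: "Poly_Mapping.keys (lin_ext g f) \<subseteq> (\<Union>m\<in>Poly_Mapping.keys f. Poly_Mapping.keys (g m))"
proof
  fix n assume "n \<in> Poly_Mapping.keys (lin_ext g f)"
  then have "(\<Sum>m\<in>Poly_Mapping.keys f. Poly_Mapping.lookup f m * Poly_Mapping.lookup (g m) n) \<noteq> 0"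
    by (simp add: in_keys_iff lin_ext_def lookup_sum)
  then obtain m where "m \<in> Poly_Mapping.keys f" "Poly_Mapping.lookup f m * Poly_Mapping.lookup (g m) n \<noteq> 0"
    by (meson sum.neutral)
  then have "m \<in> Poly_Mapping.keys f" "n \<in> Poly_Mapping.keys (g m)"
    by (auto simp: in_keys_iff)
  then show "n \<in> (\<Union>m\<in>Poly_Mapping.keys f. Poly_Mapping.keys (g m))" by blast
qed

lemma keys_nmult:
  "Poly_Mapping.keys (f \<odot> g) \<subseteq> case_prod mon_mult ` (Poly_Mapping.keys f \<times> Poly_Mapping.keys g)"
proof
  fix n assume "n \<in> Poly_Mapping.keys (f \<odot> g)"
  then obtain s where s: "s \<in> Poly_Mapping.keys f"
    "n \<in> Poly_Mapping.keys (lin_ext (\<lambda>t. Poly_Mapping.single (mon_mult s t) (1::'b)) g)"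
    using keys_lin_ext unfolding nmult_def by fastforce
  then obtain t where "t \<in> Poly_Mapping.keys g"
      "n \<in> Poly_Mapping.keys (Poly_Mapping.single (mon_mult s t) (1::'b))"
    using keys_lin_ext by fastforce
  then show "n \<in> case_prod mon_mult ` (Poly_Mapping.keys f \<times> Poly_Mapping.keys g)"
    using s by (auto split: if_splits)
qed

lemma uminus_eq_scale: "- f = scale (-1) f"
  for f :: "'m \<Rightarrow>\<^sub>0 'k::ring_1"
  by (rule poly_mapping_eqI) simp

text \<open>The leading term is taken in the order on \<open>mag option\<close>, so that the unit counts as a
  monomial and inhomogeneous elements are covered as well.\<close>

definition monic :: "'v::linorder mag option \<Rightarrow> ('v, 'k::semiring_1) nalg \<Rightarrow> bool" where
  "monic m f \<longleftrightarrow> (\<exists>r. f = Poly_Mapping.single m 1 + r \<and> Poly_Mapping.keys r \<subseteq> {..<m})"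

text \<open>By strict monotonicity of the product of monomials, every product of two terms other
  than the leading ones is strictly smaller than the product of the leading monomials.\<close>

lemma monic_nmult:
  fixes f g :: "('v::linorder, 'k::semiring_1) nalg"
  assumes "monic m f" "monic n g"
  shows "monic (mon_mult m n) (f \<odot> g)"
proof -
  from assms obtain r q where f: "f = Poly_Mapping.single m 1 + r" "Poly_Mapping.keys r \<subseteq> {..<m}"
    and g: "g = Poly_Mapping.single n 1 + q" "Poly_Mapping.keys q \<subseteq> {..<n}"
    unfolding monic_def by blast
  have le: "Poly_Mapping.keys g \<subseteq> {..n}"
  proof -
    have "Poly_Mapping.keys g \<subseteq> Poly_Mapping.keys (Poly_Mapping.single n (1::'k)) \<union> Poly_Mapping.keys q"
      unfolding g(1) by (rule Poly_Mapping.keys_add)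
    then show ?thesis using g(2) by auto
  qed
  have less: "mon_mult a b < mon_mult m n" if "a < m" "b \<le> n" for a b
  proof -
    have "mon_mult m b \<le> mon_mult m n"
    proof (cases "b = n")
      case False
      with that(2) have "b < n" by (rule le_neq_trans)
      then show ?thesis by (rule mon_mult_less_right[THEN less_imp_le])
    qed simp
    then show ?thesis using mon_mult_less_left[OF that(1), of b] by (rule less_le_trans[rotated])
  qed
  have 1: "case_prod mon_mult ` (Poly_Mapping.keys r \<times> Poly_Mapping.keys g) \<subseteq> {..<mon_mult m n}"
  proof (rule image_subsetI)
    fix p assume "p \<in> Poly_Mapping.keys r \<times> Poly_Mapping.keys g"
    with f(2) le have "fst p < m" "snd p \<le> n" by auto
    then show "case_prod mon_mult p \<in> {..<mon_mult m n}" by (simp add: case_prod_beta less)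
  qed
  have 2: "case_prod mon_mult ` (Poly_Mapping.keys (Poly_Mapping.single m (1::'k)) \<times> Poly_Mapping.keys q)
      \<subseteq> {..<mon_mult m n}"
  proof (rule image_subsetI)
    fix p assume "p \<in> Poly_Mapping.keys (Poly_Mapping.single m (1::'k)) \<times> Poly_Mapping.keys q"
    with g(2) have "fst p = m" "snd p < n" by auto
    then show "case_prod mon_mult p \<in> {..<mon_mult m n}"
      by (simp add: case_prod_beta mon_mult_less_right)
  qed
  have "f \<odot> g = Poly_Mapping.single (mon_mult m n) 1 + (Poly_Mapping.single m 1 \<odot> q + r \<odot> g)"
    unfolding f(1) nmult_add_left by (simp add: g(1) nmult_add_right nmult_mono add.assoc)
  moreover have "Poly_Mapping.keys (Poly_Mapping.single m 1 \<odot> q + r \<odot> g) \<subseteq> {..<mon_mult m n}"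
    using 1 2
    by (intro order_trans[OF Poly_Mapping.keys_add] Un_least order_trans[OF keys_nmult])
  ultimately show ?thesis unfolding monic_def by blast
qed

lemma monic_lookup:
  assumes "monic m f"
  shows "Poly_Mapping.lookup f m = 1"
proof -
  obtain r where r: "f = Poly_Mapping.single m 1 + r" "Poly_Mapping.keys r \<subseteq> {..<m}"
    using assms unfolding monic_def by blast
  then have "m \<notin> Poly_Mapping.keys r" by blast
  then show ?thesis by (simp add: r(1) lookup_add in_keys_iff)
qed

lemma monic_lookup_greater:
  assumes "monic m f" "m < n"
  shows "Poly_Mapping.lookup f n = 0"
proof -
  obtain r where r: "f = Poly_Mapping.single m 1 + r" "Poly_Mapping.keys r \<subseteq> {..<m}"
    using assms unfolding monic_def by blast
  then have "n \<notin> Poly_Mapping.keys r" using assms(2) by auto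
  then show ?thesis using assms(2) by (simp add: r(1) lookup_add in_keys_iff lookup_single when_def)
qed

lemma leading_monomial_monic:
  assumes "monic (Some s) f"
  shows "leading_monomial f = s"
  unfolding leading_monomial_def
proof (rule Max_eqI)
  have "{s. Some s \<in> Poly_Mapping.keys f} \<subseteq> the ` Poly_Mapping.keys f" by force
  then show "finite {s. Some s \<in> Poly_Mapping.keys f}" by (rule finite_subset) simp
  show "s \<in> {s. Some s \<in> Poly_Mapping.keys f}"
    using monic_lookup[OF assms] by (simp add: in_keys_iff)
  fix t assume "t \<in> {s. Some s \<in> Poly_Mapping.keys f}"
  then show "t \<le> s"
    using monic_lookup_greater[OF assms, of "Some t"] by (cases "s < t") (simp_all add: in_keys_iff)
qed

text \<open>Elements with distinct leading monomials are linearly independent: among the terms of a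
  non-trivial combination, the one with the greatest leading monomial cannot be cancelled.\<close>

lemma lin_ext_monic_eq_0:
  fixes b :: "'m \<Rightarrow> ('v::linorder, 'k::semiring_1) nalg"
  assumes "\<And>m. m \<in> J \<Longrightarrow> monic (\<tau> m) (b m)" and inj: "inj_on \<tau> J"
    and "Poly_Mapping.keys f \<subseteq> J" and zero: "lin_ext b f = 0"
  shows "f = 0"
proof (rule ccontr)
  let ?K = "Poly_Mapping.keys f"
  assume "f \<noteq> 0"
  then have ne: "\<tau> ` ?K \<noteq> {}" by simp
  have "Max (\<tau> ` ?K) \<in> \<tau> ` ?K" using ne by (intro Max_in) auto
  then obtain m where m: "m \<in> ?K" "\<tau> m = Max (\<tau> ` ?K)" by auto
  have less: "\<tau> n < \<tau> m" if "n \<in> ?K" "n \<noteq> m" for n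
  proof -
    have "\<tau> n \<noteq> \<tau> m" using inj_onD[OF inj] that m assms(3) by blast
    moreover have "\<tau> n \<le> \<tau> m" unfolding m(2) using that by simp
    ultimately show ?thesis by simp
  qed
  have "Poly_Mapping.lookup (lin_ext b f) (\<tau> m)
      = (\<Sum>n\<in>?K. Poly_Mapping.lookup f n * Poly_Mapping.lookup (b n) (\<tau> m))"
    by (simp add: lin_ext_def lookup_sum)
  also have "\<dots> = (\<Sum>n\<in>{m}. Poly_Mapping.lookup f n * Poly_Mapping.lookup (b n) (\<tau> m))"
  proof (rule sum.mono_neutral_right)
    show "\<forall>n\<in>?K - {m}. Poly_Mapping.lookup f n * Poly_Mapping.lookup (b n) (\<tau> m) = 0"
    proof
      fix n assume n: "n \<in> ?K - {m}"
      then have "monic (\<tau> n) (b n)" using assms(1,3) by blast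
      from monic_lookup_greater[OF this less] n
      show "Poly_Mapping.lookup f n * Poly_Mapping.lookup (b n) (\<tau> m) = 0" by simp
    qed
  qed (use m in auto)
  also have "\<dots> = Poly_Mapping.lookup f m"
    using monic_lookup[OF assms(1)] m(1) assms(3) by auto
  finally show False using zero m(1) by (simp add: in_keys_iff)
qed

section \<open>Homogeneous components\<close>

definition hom_part :: "nat \<Rightarrow> ('v, 'k::semiring_1) nalg \<Rightarrow> ('v, 'k) nalg" where
  "hom_part n = lin_ext (\<lambda>m. if mon_deg m = n then Poly_Mapping.single m 1 else 0)"

lemma hom_part_add: "hom_part n (f + g) = hom_part n f + hom_part n g"
  by (simp add: hom_part_def lin_ext_add)

lemma hom_part_scale: "hom_part n (scale c f) = scale c (hom_part n f)"
  by (simp add: hom_part_def lin_ext_scale)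

lemma hom_part_zero [simp]: "hom_part n 0 = 0"
  by (simp add: hom_part_def)

lemma lookup_hom_part:
  "Poly_Mapping.lookup (hom_part n f) m = (if mon_deg m = n then Poly_Mapping.lookup f m else 0)"
proof (induction f rule: nalg_induct)
  case (mono k)
  then show ?case by (auto simp: hom_part_def lookup_single when_def)
qed (auto simp: hom_part_add hom_part_scale lookup_add)

lemma homogeneous_hom_part: "homogeneous n (hom_part n f)"
  by (auto simp: homogeneous_def in_keys_iff lookup_hom_part split: if_splits)

lemma hom_part_homogeneous:
  assumes "homogeneous k f"
  shows "hom_part n f = (if n = k then f else 0)"
  by (rule poly_mapping_eqI) (use assms in \<open>auto simp: homogeneous_def in_keys_iff lookup_hom_part\<close>)

lemma homogeneous_single: "homogeneous (mon_deg m) (Poly_Mapping.single m c)"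
  by (auto simp: homogeneous_def split: if_splits)

lemma homogeneous_add: "homogeneous n f \<Longrightarrow> homogeneous n g \<Longrightarrow> homogeneous n (f + g)"
  for f :: "('v, 'k::semiring_1) nalg"
  using Poly_Mapping.keys_add[of f g] by (auto simp: homogeneous_def)

lemma homogeneous_scale: "homogeneous n f \<Longrightarrow> homogeneous n (scale c f)"
  by (auto simp: homogeneous_def in_keys_iff)

lemma homogeneous_nmult: "homogeneous a f \<Longrightarrow> homogeneous b g \<Longrightarrow> homogeneous (a + b) (f \<odot> g)"
  using keys_nmult[of f g] by (fastforce simp: homogeneous_def)

lemma homogeneous_D_mag: "homogeneous (deg s - 1) (D_mag s :: 'k::semiring_1 A)"
proof (induction s)
  case (Gen v)
  then show ?case using homogeneous_single[of None "1::'k"] by (simp add: nalg_one_def)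
next
  case (Br s t)
  have "homogeneous (deg s - 1 + deg t) (D_mag s \<odot> mag_mono t :: 'k A)"
    using homogeneous_nmult[OF Br(1)] homogeneous_single[of "Some t" "1::'k"] by simp
  moreover have "homogeneous (deg s + (deg t - 1)) (mag_mono s \<odot> D_mag t :: 'k A)"
    using homogeneous_nmult[OF _ Br(2)] homogeneous_single[of "Some s" "1::'k"] by simp
  moreover have "deg s - 1 + deg t = deg (Br s t) - 1" "deg s + (deg t - 1) = deg (Br s t) - 1"
    using deg_pos[of s] deg_pos[of t] by simp_all
  ultimately show ?case by (simp add: homogeneous_add)
qed

text \<open>\<open>D\<close> lowers degrees by one and \<open>L\<close> raises them by one; so the homogeneous components of a
  constant are constants, and the decomposition of \<open>A\<close> into \<open>constants\<close> and \<open>L A\<close> is graded.\<close>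

lemma D_hom_part: "D (hom_part (Suc n) f) = hom_part n (D f)"
  for f :: "'k::semiring_1 A"
proof (induction f rule: nalg_induct)
  case (mono m)
  show ?case
  proof (cases m)
    case None
    then show ?thesis by (simp add: D_def hom_part_def)
  next
    case (Some s)
    then show ?thesis
      using deg_pos[of s]
      by (auto simp: D_def hom_part_homogeneous[OF homogeneous_D_mag] hom_part_homogeneous[OF homogeneous_single])
  qed
qed (simp_all add: hom_part_add hom_part_scale D_add D_scale)

lemma L_hom_part: "L (hom_part n f) = hom_part (Suc n) (L f)"
  for f :: "'k::comm_semiring_1 A"
proof (induction f rule: nalg_induct)
  case (mono m)
  show ?case
    by (auto simp: L_def var_def nmult_mono hom_part_homogeneous[OF homogeneous_single])
qed (simp_all add: hom_part_add hom_part_scale L_def nmult_add_right nmult_scale_right)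

section \<open>The projection onto the constants\<close>

lemma zero_in_constants: "0 \<in> constants"
  by (simp add: constants_def)

lemma one_in_constants: "nalg_one \<in> constants"
  by (simp add: constants_def D_def nalg_one_def)

lemma add_in_constants: "f \<in> constants \<Longrightarrow> g \<in> constants \<Longrightarrow> f + g \<in> constants"
  by (simp add: constants_def D_add)

lemma nmult_in_constants: "f \<in> constants \<Longrightarrow> g \<in> constants \<Longrightarrow> f \<odot> g \<in> constants"
  for f g :: "'k::comm_semiring_1 A"
  by (simp add: constants_def D_nmult)

lemma L_add: "L (f + g) = L f + L g"
  by (simp add: L_def nmult_add_right)

lemma L_scale: "L (scale c f) = scale c (L f)"
  for c :: "'k::comm_semiring_1"
  by (simp add: L_def nmult_scale_right)

lemma L_sum: "L (\<Sum>i\<in>S. h i) = (\<Sum>i\<in>S. L (h i))"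
  by (induction S rule: infinite_finite_induct) (auto simp: L_add)

text \<open>Prepending a constant \<open>c\<close> to the Taylor coefficients of \<open>g\<close> yields those of \<open>c + L g\<close>, so
  uniqueness of the expansion makes the sum of \<open>constants\<close> and \<open>L A\<close> direct.\<close>

lemma \<Phi>_eqI:
  fixes f :: "'k::field_char_0 A"
  assumes "c \<in> constants" "f = c + L g"
  shows "\<Phi> f = c"
proof -
  obtain a where "is_taylor g a" using ex1_taylor by blast
  then obtain N where a: "\<And>j. a j \<in> constants" "\<forall>j\<ge>N. a j = 0" "g = (\<Sum>j<N. (L ^^ j) (a j))"
    unfolding is_taylor_bound by blast
  let ?b = "case_nat c a"
  have "f = (\<Sum>j<Suc N. (L ^^ j) (?b j))"
    unfolding sum.lessThan_Suc_shift by (simp add: assms(2) a(3) L_sum)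
  moreover have "?b j = 0" if "j \<ge> Suc N" for j using that a(2) by (cases j) auto
  moreover have "?b j \<in> constants" for j using a(1) assms(1) by (cases j) auto
  ultimately have "is_taylor f ?b" unfolding is_taylor_bound by blast
  then have "(THE a. is_taylor f a) = ?b" using ex1_taylor by (rule the1_equality[rotated])
  then show ?thesis by (simp add: \<Phi>_def taylor_coeff_def)
qed

lemma \<Phi>_decomposition:
  fixes f :: "'k::field_char_0 A"
  obtains g where "\<Phi> f \<in> constants" "f = \<Phi> f + L g"
proof -
  obtain a where t: "is_taylor f a" using ex1_taylor by blast
  then obtain N where a: "\<And>j. a j \<in> constants" "\<forall>j\<ge>N. a j = 0" "f = (\<Sum>j<N. (L ^^ j) (a j))"
    unfolding is_taylor_bound by blast
  have "f = (\<Sum>j<Suc N. (L ^^ j) (a j))" using a by simp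
  then have "f = a 0 + L (\<Sum>j<N. (L ^^ j) (a (Suc j)))"
    unfolding sum.lessThan_Suc_shift by (simp add: L_sum)
  with that[of "\<Sum>j<N. (L ^^ j) (a (Suc j))"] \<Phi>_eqI[OF a(1) this] a(1) show thesis by simp
qed

lemma \<Phi>_in_constants: "\<Phi> f \<in> constants"
  for f :: "'k::field_char_0 A"
  by (rule \<Phi>_decomposition[of f])

lemma \<Phi>_constant: "f \<in> constants \<Longrightarrow> \<Phi> f = f"
  for f :: "'k::field_char_0 A"
  by (rule \<Phi>_eqI[of _ _ 0]) auto

lemma \<Phi>_L: "\<Phi> (L f) = 0"
  for f :: "'k::field_char_0 A"
  by (rule \<Phi>_eqI[of _ _ f]) (auto simp: zero_in_constants)

lemma \<Phi>_add: "\<Phi> (f + g) = \<Phi> f + \<Phi> g"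
  for f g :: "'k::field_char_0 A"
proof -
  obtain u v where f: "f = \<Phi> f + L u" and g: "g = \<Phi> g + L v"
    using \<Phi>_decomposition by metis
  have "f + g = (\<Phi> f + \<Phi> g) + L (u + v)"
    by (subst f, subst g) (simp add: L_add ac_simps)
  then show ?thesis by (intro \<Phi>_eqI[of _ _ "u + v"] add_in_constants \<Phi>_in_constants)
qed

lemma \<Phi>_scale: "\<Phi> (scale c f) = scale c (\<Phi> f)"
  for f :: "'k::field_char_0 A"
proof -
  obtain u where f: "f = \<Phi> f + L u"
    using \<Phi>_decomposition by metis
  have "scale c f = scale c (\<Phi> f) + L (scale c u)"
    by (subst f) (simp add: L_scale scale_add)
  then show ?thesis by (intro \<Phi>_eqI[of _ _ "scale c u"] scale_constants \<Phi>_in_constants)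
qed

lemma \<Phi>_eq_lin_ext: "\<Phi> f = lin_ext (\<lambda>m. \<Phi> (Poly_Mapping.single m 1)) f"
  for f :: "'k::field_char_0 A"
  by (induction f rule: nalg_induct)
    (simp_all add: lin_ext_add lin_ext_scale \<Phi>_add \<Phi>_scale \<Phi>_constant zero_in_constants)

text \<open>The homogeneous component of the decomposition \<open>f = \<Phi> f + L g\<close> in the degree of \<open>f\<close> is again
  a decomposition of \<open>f\<close>, and the decomposition is unique.\<close>

lemma homogeneous_\<Phi>:
  fixes f :: "'k::field_char_0 A"
  assumes "homogeneous (Suc n) f"
  shows "homogeneous (Suc n) (\<Phi> f)"
proof -
  obtain g where g: "\<Phi> f \<in> constants" "f = \<Phi> f + L g" by (rule \<Phi>_decomposition)
  have "hom_part (Suc n) f = hom_part (Suc n) (\<Phi> f) + L (hom_part n g)"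
    by (subst g(2)) (simp add: hom_part_add L_hom_part)
  then have "f = hom_part (Suc n) (\<Phi> f) + L (hom_part n g)"
    by (simp add: hom_part_homogeneous[OF assms])
  moreover have "hom_part (Suc n) (\<Phi> f) \<in> constants"
    using g(1) by (simp add: constants_def D_hom_part)
  ultimately have "\<Phi> f = hom_part (Suc n) (\<Phi> f)" by (rule \<Phi>_eqI[rotated])
  then show ?thesis using homogeneous_hom_part by metis
qed

lemma mem_\<Gamma>_iff: "s \<in> \<Gamma> \<longleftrightarrow> (\<exists>s1 s2. s = Br s1 s2 \<and> s1 \<noteq> X)"
  unfolding \<Gamma>_def by (cases s) auto

text \<open>The difference of \<open>\<Phi> s\<close> and \<open>s\<close> lies in \<open>L A\<close> and is homogeneous of the degree of \<open>s\<close>. Its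
  monomials thus have the form \<open>x t\<close> with the degree of \<open>s = s\<^sub>1 s\<^sub>2\<close>, and \<open>x < s\<^sub>1\<close>.\<close>

lemma monic_\<Phi>:
  assumes "s \<in> \<Gamma>"
  shows "monic (Some s) (\<Phi> (mag_mono s) :: 'k::field_char_0 A)"
proof -
  obtain s1 s2 where s: "s = Br s1 s2" "s1 \<noteq> X" using assms mem_\<Gamma>_iff by blast
  obtain n where n: "deg s = Suc n" using deg_pos[of s] by (cases "deg s") auto
  let ?f = "mag_mono s :: 'k A"
  have hs: "homogeneous (deg s) ?f" using homogeneous_single[of "Some s" "1::'k"] by simp
  obtain g where g: "?f = \<Phi> ?f + L g" by (rule \<Phi>_decomposition)
  define r where "r = scale (-1) (L g)"
  have r: "\<Phi> ?f = ?f + r"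
    unfolding r_def uminus_eq_scale[symmetric] by (subst (2) g) simp
  have "r = \<Phi> ?f + scale (-1) ?f" unfolding r uminus_eq_scale[symmetric] by simp
  moreover have "homogeneous (deg s) (scale (-1) ?f)"
    using hs by (rule homogeneous_scale)
  ultimately have hom: "homogeneous (deg s) r"
    using homogeneous_\<Phi>[of n ?f] hs homogeneous_add n by auto
  have "m < Some s" if m: "m \<in> Poly_Mapping.keys r" for m
  proof -
    have "m \<in> Poly_Mapping.keys (L g)" using m by (auto simp: r_def in_keys_iff)
    then obtain k where k: "m = mon_mult (Some X) k"
      using keys_nmult[of xA g] by (auto simp: L_def var_def split: if_splits)
    have d: "mon_deg m = deg s" using hom m by (auto simp: homogeneous_def)
    have "X < s1"
    proof (rule less_of_deg_less)
      show "deg X < deg s1"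
      proof (cases s1)
        case (Br u v)
        then show ?thesis using deg_pos[of u] deg_pos[of v] by simp
      qed (use s in simp)
    qed
    show ?thesis
    proof (cases k)
      case None
      then show ?thesis using d k deg_pos[of s1] deg_pos[of s2] by (simp add: s)
    next
      case (Some t)
      then show ?thesis using d k \<open>X < s1\<close> by (simp add: s less_mag_def)
    qed
  qed
  then show ?thesis unfolding monic_def using r by blast
qed

section \<open>Submagmas of a free magma\<close>

text \<open>The magma homomorphism from the free magma that extends a map of generators.\<close>

primrec mag_bind :: "('w \<Rightarrow> 'v mag) \<Rightarrow> 'w mag \<Rightarrow> 'v mag" where
  "mag_bind w (Gen i) = w i"
| "mag_bind w (Br u v) = Br (mag_bind w u) (mag_bind w v)"

lemma Br_in_image_iff [simp]: "Br s t \<in> case_prod Br ` (S \<times> T) \<longleftrightarrow> s \<in> S \<and> t \<in> T"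
  by force

text \<open>A submagma of a free magma is free on its indecomposable elements: a tree in \<open>G\<close> is cut
  along its unique factorization as long as both factors stay in \<open>G\<close>, and the cut pieces are
  the indecomposable ones.\<close>

lemma submagma_free:
  assumes closed: "\<And>s t. s \<in> G \<Longrightarrow> t \<in> G \<Longrightarrow> Br s t \<in> G"
    and w: "bij_betw w I (G - case_prod Br ` (G \<times> G))"
  shows "bij_betw (mag_bind w) {u. gens u \<subseteq> I} G"
proof -
  have gen: "w i \<in> G" "w i \<notin> case_prod Br ` (G \<times> G)" if "i \<in> I" for i
    using bij_betwE[OF w] that by blast+
  have mem: "mag_bind w u \<in> G" if "gens u \<subseteq> I" for u
    using that by (induction u) (auto simp: gen closed)
  have inj: "u = v" if "gens u \<subseteq> I" "gens v \<subseteq> I" "mag_bind w u = mag_bind w v" for u v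
    using that
  proof (induction u arbitrary: v)
    case (Gen i)
    show ?case
    proof (cases v)
      case (Gen j)
      then show ?thesis using Gen.prems w by (auto simp: bij_betw_def dest: inj_onD)
    next
      case (Br v1 v2)
      then have "w i = Br (mag_bind w v1) (mag_bind w v2)" using Gen.prems(3) by simp
      moreover have "mag_bind w v1 \<in> G" "mag_bind w v2 \<in> G"
        using Gen.prems(2) Br by (simp_all add: mem)
      ultimately have "w i \<in> case_prod Br ` (G \<times> G)" by simp
      then show ?thesis using gen(2)[of i] Gen.prems(1) by simp
    qed
  next
    case (Br u1 u2)
    show ?case
    proof (cases v)
      case (Gen j)
      then have "w j = Br (mag_bind w u1) (mag_bind w u2)" using Br.prems(3) by simp
      moreover have "mag_bind w u1 \<in> G" "mag_bind w u2 \<in> G"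
        using Br.prems(1) by (simp_all add: mem)
      ultimately have "w j \<in> case_prod Br ` (G \<times> G)" by simp
      then show ?thesis using gen(2)[of j] Gen Br.prems(2) by simp
    next
      case v: (Br v1 v2)
      then show ?thesis using Br.IH[of v1] Br.IH(2)[of v2] Br.prems by auto
    qed
  qed
  have surj: "s \<in> mag_bind w ` {u. gens u \<subseteq> I}" if "s \<in> G" for s
    using that
  proof (induction s)
    case (Gen a)
    then have "Gen a \<in> w ` I" unfolding bij_betw_imp_surj_on[OF w] by auto
    then obtain i where "i \<in> I" "Gen a = mag_bind w (Gen i)" by auto
    then show ?case by (intro image_eqI[of _ _ "Gen i"]) auto
  next
    case (Br s t)
    show ?case
    proof (cases "s \<in> G \<and> t \<in> G")
      case True
      then obtain u v where "gens u \<subseteq> I" "s = mag_bind w u" "gens v \<subseteq> I" "t = mag_bind w v"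
        using Br.IH by blast
      then show ?thesis by (intro image_eqI[of _ _ "Br u v"]) simp_all
    next
      case False
      then have "Br s t \<in> w ` I" unfolding bij_betw_imp_surj_on[OF w] using Br.prems by simp
      then obtain i where "i \<in> I" "Br s t = mag_bind w (Gen i)" by auto
      then show ?thesis by (intro image_eqI[of _ _ "Gen i"]) auto
    qed
  qed
  show ?thesis unfolding bij_betw_def inj_on_def using mem inj surj by blast
qed

lemma Br_in_\<Gamma>: "s \<in> \<Gamma> \<Longrightarrow> Br s t \<in> \<Gamma>"
  by (auto simp: mem_\<Gamma>_iff)

lemma \<Omega>_eq: "\<Omega> = \<Gamma> - case_prod Br ` (\<Gamma> \<times> \<Gamma>)"
proof (rule set_eqI)
  show "s \<in> \<Omega> \<longleftrightarrow> s \<in> \<Gamma> - case_prod Br ` (\<Gamma> \<times> \<Gamma>)" for s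
    by (cases s) (auto simp: \<Omega>_def mem_\<Gamma>_iff[of "Br _ _"] mem_\<Gamma>_iff[of "Gen _"])
qed

section \<open>Free generation of the constants\<close>

text \<open>The basis of the free algebra is mapped to elements whose leading monomials are \<open>1\<close> and,
  without repetition, the elements of \<open>\<Gamma>\<close>. This gives injectivity at once. It also gives
  surjectivity, as these leading monomials exhaust a set of monomials complementary to \<open>L A\<close>.\<close>

theorem \<Phi>_\<Omega>_freely_generates:
  fixes y :: "'i \<Rightarrow> 'k::field_char_0 A"
  assumes w: "bij_betw w I \<Omega>" and y: "\<And>i. i \<in> I \<Longrightarrow> y i = \<Phi> (mag_mono (w i))"
  shows "freely_generates I y constants"
proof -
  let ?F = "free_nalg_on I :: ('i, 'k) nalg set"
  let ?b = "case_option nalg_one (mag_eval y)"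
  let ?J = "{m. \<forall>u. m = Some u \<longrightarrow> gens u \<subseteq> I}"
  have bij: "bij_betw (mag_bind w) {u. gens u \<subseteq> I} \<Gamma>"
    by (rule submagma_free) (use w in \<open>auto simp: Br_in_\<Gamma> \<Omega>_eq\<close>)
  have wI: "w i \<in> \<Gamma>" if "i \<in> I" for i
    using w that by (auto simp: bij_betw_def \<Omega>_eq)
  have const: "mag_eval y u \<in> constants" if "gens u \<subseteq> I" for u
    using that by (induction u) (auto simp: y \<Phi>_in_constants nmult_in_constants)
  have monic: "monic (Some (mag_bind w u)) (mag_eval y u)" if "gens u \<subseteq> I" for u
    using that
  proof (induction u)
    case (Gen i)
    then show ?case using monic_\<Phi>[OF wI] by (simp add: y)
  next
    case (Br u v)
    then show ?case using monic_nmult by fastforce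
  qed

  have "subst y f \<in> constants" if "f \<in> ?F" for f
  proof -
    have "?b m \<in> constants" if "m \<in> Poly_Mapping.keys f" for m
      using that \<open>f \<in> ?F\<close> const one_in_constants by (cases m) (auto simp: free_nalg_on_def)
    then have "(\<Sum>m\<in>S. scale (Poly_Mapping.lookup f m) (?b m)) \<in> constants"
      if "S \<subseteq> Poly_Mapping.keys f" for S
      using that by (induction S rule: infinite_finite_induct)
        (auto simp: zero_in_constants add_in_constants scale_constants)
    then show ?thesis by (simp add: subst_def lin_ext_def)
  qed
  moreover have "inj_on (subst y) ?F"
  proof (rule inj_onI)
    fix f g assume fg: "f \<in> ?F" "g \<in> ?F" "subst y f = subst y g"
    have "subst y f = subst y (f - g) + subst y g" by (simp flip: subst_add)
    then have 0: "lin_ext ?b (f - g) = 0" using fg(3) by (simp add: subst_def)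
    have "f - g = 0"
    proof (rule lin_ext_monic_eq_0[OF _ _ _ 0])
      show "monic (map_option (mag_bind w) m) (?b m)" if "m \<in> ?J" for m
      proof (cases m)
        case None
        then show ?thesis by (auto simp: monic_def nalg_one_def)
      qed (use that monic in auto)
      show "inj_on (map_option (mag_bind w)) ?J"
        using bij by (auto simp: inj_on_def bij_betw_def map_option_case split: option.splits)
      show "Poly_Mapping.keys (f - g) \<subseteq> ?J"
        using keys_diff[of f g] fg(1,2) by (fastforce simp: free_nalg_on_def)
    qed
    then show "f = g" by simp
  qed
  moreover have "constants \<subseteq> subst y ` ?F"
  proof -
    let ?S = "subst y ` ?F"
    have S_add: "f + g \<in> ?S" if "f \<in> ?S" "g \<in> ?S" for f g
    proof -
      from that obtain f' g' where *: "f' \<in> ?F" "f = subst y f'" "g' \<in> ?F" "g = subst y g'" by auto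
      then have "f' + g' \<in> ?F"
        using Poly_Mapping.keys_add[of f' g'] by (fastforce simp: free_nalg_on_def)
      then show ?thesis using * by (auto simp flip: subst_add)
    qed
    have S_scale: "scale c f \<in> ?S" if "f \<in> ?S" for c f
    proof -
      from that obtain f' where *: "f' \<in> ?F" "f = subst y f'" by auto
      then have "scale c f' \<in> ?F" by (auto simp: free_nalg_on_def in_keys_iff)
      then show ?thesis using * by (auto simp flip: subst_scale)
    qed
    have S_0: "0 \<in> ?S"
      by (rule image_eqI[of _ _ 0]) (auto simp: subst_def free_nalg_on_def)
    have S_1: "nalg_one \<in> ?S"
      by (rule image_eqI[of _ _ nalg_one])
        (rule subst_nalg_one[symmetric], auto simp: free_nalg_on_def nalg_one_def)
    have S_eval: "mag_eval y u \<in> ?S" if "gens u \<subseteq> I" for u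
      by (rule image_eqI[of _ _ "Poly_Mapping.single (Some u) 1"])
        (use that in \<open>auto simp: subst_def free_nalg_on_def split: if_splits\<close>)
    have S_\<Phi>: "\<Phi> f \<in> ?S"
      if "\<And>m. m \<in> Poly_Mapping.keys f \<Longrightarrow> \<Phi> (Poly_Mapping.single m 1) \<in> ?S" for f
    proof -
      have "(\<Sum>m\<in>T. scale (Poly_Mapping.lookup f m) (\<Phi> (Poly_Mapping.single m 1))) \<in> ?S"
        if "T \<subseteq> Poly_Mapping.keys f" for T
        using that \<open>\<And>m. m \<in> Poly_Mapping.keys f \<Longrightarrow> _ m\<close>
        by (induction T rule: infinite_finite_induct) (auto intro!: S_0 S_add S_scale)
      then show ?thesis unfolding \<Phi>_eq_lin_ext[of f] lin_ext_def by blast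
    qed
    have S_None: "\<Phi> (Poly_Mapping.single None 1) \<in> ?S"
    proof -
      have "\<Phi> (nalg_one :: 'k A) = nalg_one" by (rule \<Phi>_constant[OF one_in_constants])
      with S_1 show ?thesis by (simp add: nalg_one_def)
    qed
    \<comment> \<open>If \<open>mag_eval y u\<close> has leading monomial \<open>s\<close>, then applying \<open>\<Phi>\<close>, which fixes this constant,
      expresses \<open>\<Phi> s\<close> by \<open>mag_eval y u\<close> and the images under \<open>\<Phi>\<close> of smaller monomials.\<close>
    have S_mono: "\<Phi> (mag_mono s) \<in> ?S" for s
    proof (induction s rule: M_less_induct)
      case (less s)
      show ?case
      proof (cases "s \<in> \<Gamma>")
        case False
        then consider "s = X" | t where "s = Br X t" by (cases s) (auto simp: mem_\<Gamma>_iff)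
        then obtain m where "Some s = mon_mult (Some X) m"
        proof cases
          case 1
          then show thesis using that[of None] by simp
        next
          case 2
          then show thesis using that[of "Some t" for t] by simp
        qed
        then have "mag_mono s = L (Poly_Mapping.single m 1 :: 'k A)"
          by (simp add: L_def var_def nmult_mono)
        then show ?thesis using S_0 by (simp add: \<Phi>_L)
      next
        case True
        then have "s \<in> mag_bind w ` {u. gens u \<subseteq> I}"
          using bij by (simp add: bij_betw_imp_surj_on)
        then obtain u where u: "gens u \<subseteq> I" "mag_bind w u = s" by blast
        then obtain r where r: "mag_eval y u = mag_mono s + r" "Poly_Mapping.keys r \<subseteq> {..<Some s}"
          using monic unfolding monic_def by blast
        have "\<Phi> r \<in> ?S"
        proof (rule S_\<Phi>)
          fix m assume "m \<in> Poly_Mapping.keys r"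
          then show "\<Phi> (Poly_Mapping.single m 1) \<in> ?S"
            using r(2) less S_None by (cases m) auto
        qed
        moreover have "mag_eval y u = \<Phi> (mag_mono s) + \<Phi> r"
          using \<Phi>_constant[OF const[OF u(1)]] by (simp add: r(1) \<Phi>_add)
        then have "\<Phi> (mag_mono s) = mag_eval y u + scale (-1) (\<Phi> r)"
          by (simp flip: uminus_eq_scale)
        ultimately show ?thesis using S_add S_scale S_eval[OF u(1)] by metis
      qed
    qed
    show ?thesis
    proof
      fix f :: "'k A" assume "f \<in> constants"
      moreover have "\<Phi> f \<in> ?S"
      proof (rule S_\<Phi>)
        fix m show "\<Phi> (Poly_Mapping.single m 1) \<in> ?S" by (cases m) (auto simp: S_None S_mono)
      qed
      ultimately show "f \<in> ?S" by (simp add: \<Phi>_constant)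
    qed
  qed
  ultimately show ?thesis unfolding freely_generates_def bij_betw_def by blast
qed

section \<open>Counting monomials\<close>

unbundle fps_syntax

definition deg_gf :: "M set \<Rightarrow> real fps" where
  "deg_gf S = Abs_fps (\<lambda>n. real (card {s \<in> S. deg s = n}))"

lemma deg_gf_Un: "S \<inter> T = {} \<Longrightarrow> deg_gf (S \<union> T) = deg_gf S + deg_gf T"
proof (rule fps_ext)
  fix n assume "S \<inter> T = {}"
  moreover have "{s \<in> S \<union> T. deg s = n} = {s \<in> S. deg s = n} \<union> {s \<in> T. deg s = n}" by auto
  moreover have "{s \<in> S. deg s = n} \<inter> {s \<in> T. deg s = n} = {}"
    using \<open>S \<inter> T = {}\<close> by blast
  ultimately show "deg_gf (S \<union> T) $ n = (deg_gf S + deg_gf T) $ n"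
    by (simp add: deg_gf_def finite_deg_eq card_Un_disjoint)
qed

text \<open>Unique factorization in the free magma turns products of sets into products of series.\<close>

lemma deg_gf_Br: "deg_gf (case_prod Br ` (S \<times> T)) = deg_gf S * deg_gf T"
proof (rule fps_ext)
  fix n
  let ?B = "\<lambda>i. case_prod Br ` ({s \<in> S. deg s = i} \<times> {t \<in> T. deg t = n - i})"
  have "{s \<in> case_prod Br ` (S \<times> T). deg s = n} = (\<Union>i\<in>{0..n}. ?B i)" by force
  then have "card {s \<in> case_prod Br ` (S \<times> T). deg s = n} = card (\<Union>i\<in>{0..n}. ?B i)" by simp
  also have "\<dots> = (\<Sum>i\<in>{0..n}. card (?B i))"
    by (rule card_UN_disjoint) (auto simp: finite_deg_eq)
  also have "\<dots> = (\<Sum>i=0..n. card {s \<in> S. deg s = i} * card {t \<in> T. deg t = n - i})"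
    by (intro sum.cong refl) (simp add: card_image inj_on_def card_cartesian_product)
  finally show "deg_gf (case_prod Br ` (S \<times> T)) $ n = (deg_gf S * deg_gf T) $ n"
    by (simp add: deg_gf_def fps_mult_nth)
qed

lemma deg_gf_X: "deg_gf {X} = fps_X"
proof (rule fps_ext)
  fix n
  have "{s \<in> {X}. deg s = n} = (if n = 1 then {X} else {})" by auto
  then show "deg_gf {X} $ n = fps_X $ n" by (simp add: deg_gf_def fps_X_def)
qed

lemma deg_gf_UNIV: "deg_gf UNIV = fps_X + deg_gf UNIV * deg_gf UNIV"
proof -
  have "s \<in> {X} \<union> case_prod Br ` (UNIV \<times> UNIV)" for s :: M by (cases s) auto
  then have "(UNIV :: M set) = {X} \<union> case_prod Br ` (UNIV \<times> UNIV)" by blast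
  then have "deg_gf UNIV = deg_gf ({X} \<union> case_prod Br ` (UNIV \<times> UNIV))" by simp
  also have "\<dots> = fps_X + deg_gf UNIV * deg_gf UNIV"
    by (subst deg_gf_Un) (auto simp: deg_gf_Br[of UNIV UNIV, simplified] deg_gf_X)
  finally show ?thesis .
qed

lemma deg_gf_\<Gamma>: "deg_gf UNIV = fps_X + fps_X * deg_gf UNIV + deg_gf \<Gamma>"
proof -
  have "s \<in> ({X} \<union> case_prod Br ` ({X} \<times> UNIV)) \<union> \<Gamma>" for s :: M
    by (cases s) (auto simp: mem_\<Gamma>_iff)
  then have "(UNIV :: M set) = ({X} \<union> case_prod Br ` ({X} \<times> UNIV)) \<union> \<Gamma>" by blast
  then have "deg_gf UNIV = deg_gf (({X} \<union> case_prod Br ` ({X} \<times> UNIV)) \<union> \<Gamma>)" by simp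
  also have "\<dots> = deg_gf ({X} \<union> case_prod Br ` ({X} \<times> UNIV)) + deg_gf \<Gamma>"
    by (rule deg_gf_Un) (auto simp: mem_\<Gamma>_iff)
  also have "deg_gf ({X} \<union> case_prod Br ` ({X} \<times> UNIV)) = deg_gf {X} + deg_gf (case_prod Br ` ({X} \<times> UNIV))"
    by (rule deg_gf_Un) auto
  finally show ?thesis by (simp only: deg_gf_Br deg_gf_X)
qed

lemma deg_gf_\<Omega>: "deg_gf \<Gamma> = deg_gf \<Omega> + deg_gf \<Gamma> * deg_gf \<Gamma>"
proof -
  have "\<Gamma> = \<Omega> \<union> case_prod Br ` (\<Gamma> \<times> \<Gamma>)" by (auto simp: \<Omega>_eq Br_in_\<Gamma>)
  then have "deg_gf \<Gamma> = deg_gf (\<Omega> \<union> case_prod Br ` (\<Gamma> \<times> \<Gamma>))" by simp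
  also have "\<dots> = deg_gf \<Omega> + deg_gf (case_prod Br ` (\<Gamma> \<times> \<Gamma>))"
    by (rule deg_gf_Un) (auto simp: \<Omega>_eq)
  finally show ?thesis by (simp only: deg_gf_Br)
qed

text \<open>This two-term recursion identifies the Catalan numbers without extracting a square root
  of a power series; the differential equation for \<open>C\<close> below gives the same recursion.\<close>

lemma catalan_Suc:
  assumes "1 \<le> n"
  shows "real (Suc n) * real (catalan (Suc n)) = (4 * real n - 2) * real (catalan n)"
proof -
  obtain m where n: "n = Suc m" using assms by (cases n) auto
  define x F g where "x = real m" and "F = (fact (2 * m) :: real)" and "g = (fact m :: real)"
  have c: "real (catalan n) = F / ((x + 1) * g * g)"
    by (simp add: n catalan_exact x_def F_def g_def algebra_simps)
  have "fact (2 * Suc m) = (2 * x + 2) * ((2 * x + 1) * F)"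
    by (simp add: x_def F_def algebra_simps)
  then have c': "real (catalan (Suc n)) =
      (2 * x + 2) * ((2 * x + 1) * F) / ((x + 2) * ((x + 1) * g) * ((x + 1) * g))"
    by (simp add: n catalan_exact x_def g_def algebra_simps)
  have nz: "x + 1 \<noteq> 0" "x + 2 \<noteq> 0" "g \<noteq> 0" by (simp_all add: x_def g_def)
  have "(x + 2) * ((2 * x + 2) * ((2 * x + 1) * F) / ((x + 2) * ((x + 1) * g) * ((x + 1) * g)))
      = (4 * x + 2) * (F / ((x + 1) * g * g))"
    unfolding times_divide_eq_right using nz by (subst frac_eq_eq) (simp_all, algebra)
  then show ?thesis unfolding c c' by (simp add: n x_def add_ac)
qed

text \<open>Differentiating \<open>C = X + C\<^sup>2\<close> gives \<open>(1 - 2 C) C' = 1\<close>. Since \<open>(1 - 2 C)\<^sup>2 = 1 - 4 X\<close>, multiplying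
  by \<open>1 - 2 C\<close> makes the equation linear, namely \<open>(1 - 4 X) C' = 1 - 2 C\<close>, and comparing coefficients
  gives a two-term recursion.\<close>

lemma card_deg_eq_catalan:
  assumes "1 \<le> n"
  shows "card {s :: M. deg s = n} = catalan n"
proof -
  define C where "C = deg_gf UNIV"
  have eq: "C = fps_X + C * C" unfolding C_def by (rule deg_gf_UNIV)
  have "fps_deriv C = fps_deriv (fps_X + C * C)" using eq by simp
  then have d: "fps_deriv C = 1 + 2 * C * fps_deriv C" by (simp add: algebra_simps)
  have ode: "fps_deriv C - 4 * (fps_X * fps_deriv C) = 1 - 2 * C"
    using eq d by algebra
  have rec: "real (Suc n) * C $ Suc n = (4 * real n - 2) * C $ n" if "n \<ge> 1" for n
    using arg_cong[OF ode, of "\<lambda>f. f $ n"] that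
    by (cases n) (auto simp: numeral_fps_const algebra_simps)
  have "C $ n = real (catalan n)" using assms
  proof (induction n rule: dec_induct)
    case base
    have "{s :: M. deg s = 1} = {X}"
    proof -
      have "s = X" if "deg s = 1" for s :: M
        using that by (cases s) (auto simp: add_is_1)
      then show ?thesis by auto
    qed
    then show ?case by (simp add: C_def deg_gf_def catalan_def)
  next
    case (step n)
    have "real (Suc n) * C $ Suc n = real (Suc n) * real (catalan (Suc n))"
      using rec[of n] catalan_Suc[of n] step by simp
    then show ?case by simp
  qed
  then show ?thesis by (simp add: C_def deg_gf_def)
qed

text \<open>The correction terms \<open>- 3 X\<^sup>2 + X\<^sup>3\<close> in the generating function of \<open>\<Omega>\<close> cancel the contribution
  of \<open>3 X C\<close> in degree 2 and make degree 3 exceptional.\<close>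

lemma card_\<Omega>_deg:
  "real (card {s \<in> \<Omega>. deg s = n}) =
    (if n < 3 then 0 else if n = 3 then 1 else 3 * real (catalan (n - 1)) - 3 * real (catalan (n - 2)))"
proof -
  define C where "C = deg_gf UNIV"
  have "deg_gf \<Omega> = fps_X * (3 * C) - fps_X * (fps_X * (3 * C)) - 3 * fps_X ^ 2 + fps_X ^ 3"
    using deg_gf_UNIV deg_gf_\<Gamma> deg_gf_\<Omega> unfolding C_def[symmetric] by algebra
  then have o: "deg_gf \<Omega> $ n = (if n = 0 then 0 else 3 * C $ (n - 1)) - (if n < 2 then 0 else 3 * C $ (n - 2))
      - (if n = 2 then 3 else 0) + (if n = 3 then 1 else 0)"
    by (auto simp: numeral_fps_const fps_X_power_nth less_2_cases_iff numeral_2_eq_2)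
  have c: "C $ k = real (catalan k)" if "1 \<le> k" for k
    using card_deg_eq_catalan[OF that] by (simp add: C_def deg_gf_def)
  have c0: "C $ 0 = 0" by (simp add: C_def deg_gf_def)
  have cat: "catalan 1 = 1" "catalan 2 = 1" by (simp_all add: catalan_def)
  consider "n = 0" | "n = 1" | "n = 2" | "n = 3" | "n \<ge> 4" by linarith
  then have "deg_gf \<Omega> $ n =
    (if n < 3 then 0 else if n = 3 then 1 else 3 * real (catalan (n - 1)) - 3 * real (catalan (n - 2)))"
    unfolding o using cat by cases (auto simp: c c0)
  then show ?thesis by (simp add: deg_gf_def)
qed

section \<open>The sequence of generators\<close>

lemma idx_eq: "idx = {(n, i). 1 \<le> i \<and> i \<le> card {s \<in> \<Omega>. deg s = n}}"
proof -
  have "card {s \<in> \<Omega>. deg s = n} = (if n < 3 then 0 else if n = 3 then 1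
      else 3 * catalan (n - 1) - 3 * catalan (n - 2))" for n
    using card_\<Omega>_deg[of n] by (auto split: if_splits)
  then show ?thesis by (auto simp: idx_def split: if_splits)
qed

text \<open>The index \<open>i\<close> starts at 1, positions in a list start at 0.\<close>

definition \<Omega>_nth :: "nat \<times> nat \<Rightarrow> M" where
  "\<Omega>_nth = (\<lambda>(n, i). sorted_list_of_set {s \<in> \<Omega>. deg s = n} ! (i - 1))"

lemma \<Omega>_nth_mem: "(n, i) \<in> idx \<Longrightarrow> \<Omega>_nth (n, i) \<in> \<Omega> \<and> deg (\<Omega>_nth (n, i)) = n"
  using nth_mem[of "i - 1" "sorted_list_of_set {s \<in> \<Omega>. deg s = n}"] finite_deg_eq[of \<Omega> n]
  by (auto simp: idx_eq \<Omega>_nth_def)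

lemma \<Omega>_nth_less:
  assumes "(n, i) \<in> idx" "(m, j) \<in> idx" "n < m \<or> n = m \<and> i < j"
  shows "\<Omega>_nth (n, i) < \<Omega>_nth (m, j)"
proof (cases "n < m")
  case True
  then show ?thesis using \<Omega>_nth_mem assms by (intro less_of_deg_less) auto
next
  case False
  let ?l = "sorted_list_of_set {s \<in> \<Omega>. deg s = n}"
  have "?l ! (i - 1) < ?l ! (j - 1)"
    by (rule sorted_wrt_nth_less[of "(<)"]) (use False assms in \<open>auto simp: idx_eq\<close>)
  then show ?thesis using False assms by (auto simp: \<Omega>_nth_def)
qed

lemma bij_betw_\<Omega>_nth: "bij_betw \<Omega>_nth idx \<Omega>"
proof -
  have "inj_on \<Omega>_nth idx"
  proof (rule inj_onI)
    fix p q assume pq: "p \<in> idx" "q \<in> idx" "\<Omega>_nth p = \<Omega>_nth q"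
    obtain n i m j where [simp]: "p = (n, i)" "q = (m, j)" by (cases p; cases q) auto
    show "p = q"
      using \<Omega>_nth_less[of n i m j] \<Omega>_nth_less[of m j n i] pq
      by (metis \<open>p = (n, i)\<close> \<open>q = (m, j)\<close> less_irrefl linorder_neqE_nat)
  qed
  moreover have "s \<in> \<Omega>_nth ` idx" if s: "s \<in> \<Omega>" for s
  proof -
    let ?l = "sorted_list_of_set {t \<in> \<Omega>. deg t = deg s}"
    have "s \<in> set ?l" using s finite_deg_eq by simp
    then obtain k where k: "k < length ?l" "?l ! k = s" by (auto simp: in_set_conv_nth)
    then have "(deg s, Suc k) \<in> idx" by (simp add: idx_eq)
    then show ?thesis using k by (intro image_eqI[of _ _ "(deg s, Suc k)"]) (auto simp: \<Omega>_nth_def)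
  qed
  ultimately show ?thesis unfolding bij_betw_def using \<Omega>_nth_mem by auto
qed

lemma \<Omega>_nth_3_1: "\<Omega>_nth (3, 1) = Br (Br X X) X"
proof -
  have "(3, 1) \<in> idx" by (simp add: idx_def)
  have "card {s \<in> \<Omega>. deg s = 3} = 1" using card_\<Omega>_deg[of 3] by simp
  then obtain s where "{s \<in> \<Omega>. deg s = 3} = {s}" by (rule card_1_singletonE)
  moreover have "Br (Br X X) X \<in> {s \<in> \<Omega>. deg s = 3}" by (auto simp: \<Omega>_def mem_\<Gamma>_iff)
  moreover have "\<Omega>_nth (3, 1) \<in> {s \<in> \<Omega>. deg s = 3}"
    using \<Omega>_nth_mem[OF \<open>(3, 1) \<in> idx\<close>] by blast
  ultimately show ?thesis by (metis singletonD)
qed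

text \<open>Sorting each degree of \<open>\<Omega>\<close> carries over to the elements \<open>\<Phi> \<omega>\<close>, because \<open>\<omega>\<close> can be recovered as
  the leading monomial of \<open>\<Phi> \<omega>\<close>; the same fact makes \<open>\<omega> \<mapsto> \<Phi> \<omega>\<close> injective.\<close>

theorem proposition2p11:
  fixes E :: "'k::field_char_0 A set"
  assumes "E = (\<lambda>\<omega>. \<Phi> (mag_mono \<omega>)) ` \<Omega>"
  shows "E \<subseteq> constants \<and>
    (\<exists>y :: nat \<times> nat \<Rightarrow> 'k A.
       bij_betw y idx E \<and>
       y (3, 1) = taylor_coeff 0 (xpow 2 \<odot> xA) \<and>
       (\<forall>(n, i) \<in> idx. y (n, i) \<noteq> 0 \<and> homogeneous n (y (n, i))) \<and>
       (\<forall>(n, i) \<in> idx. \<forall>(m, j) \<in> idx. n < m \<or> n = m \<and> i < j \<longrightarrow>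
          leading_monomial (y (n, i)) < leading_monomial (y (m, j))) \<and>
       freely_generates idx y constants)"
proof -
  define y :: "nat \<times> nat \<Rightarrow> 'k A" where "y = (\<lambda>p. \<Phi> (mag_mono (\<Omega>_nth p)))"
  have monic: "monic (Some s) (\<Phi> (mag_mono s) :: 'k A)" if "s \<in> \<Omega>" for s
    using that by (intro monic_\<Phi>) (simp add: \<Omega>_eq)
  have lead: "leading_monomial (y p) = \<Omega>_nth p" if "p \<in> idx" for p
    using that \<Omega>_nth_mem unfolding y_def by (cases p) (auto intro!: leading_monomial_monic monic)
  have "inj_on (\<lambda>\<omega>. \<Phi> (mag_mono \<omega>) :: 'k A) \<Omega>"
    by (rule inj_onI) (metis monic leading_monomial_monic)
  then have "bij_betw (\<lambda>\<omega>. \<Phi> (mag_mono \<omega>) :: 'k A) \<Omega> E"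
    unfolding assms by (simp add: bij_betw_def)
  from bij_betw_trans[OF bij_betw_\<Omega>_nth this] have "bij_betw y idx E"
    by (simp add: y_def comp_def)
  moreover have "y (3, 1) = taylor_coeff 0 (xpow 2 \<odot> xA)"
    unfolding y_def \<Omega>_nth_3_1 \<Phi>_def
    by (simp add: xpow_def numeral_2_eq_2 L_def var_def nmult_mono)
  moreover have "y (n, i) \<noteq> 0 \<and> homogeneous n (y (n, i))" if "(n, i) \<in> idx" for n i
  proof
    show "y (n, i) \<noteq> 0"
      using monic_lookup[OF monic] \<Omega>_nth_mem[OF that] unfolding y_def by fastforce
    have "n \<noteq> 0" using \<Omega>_nth_mem[OF that] deg_neq_0 by metis
    then obtain k where "n = Suc k" by (cases n) auto
    then show "homogeneous n (y (n, i))"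
      using homogeneous_\<Phi>[of k] homogeneous_single[of "Some (\<Omega>_nth (n, i))" "1::'k"] \<Omega>_nth_mem[OF that]
      unfolding y_def by simp
  qed
  moreover have "freely_generates idx y constants"
    by (rule \<Phi>_\<Omega>_freely_generates[OF bij_betw_\<Omega>_nth]) (simp add: y_def)
  moreover have "E \<subseteq> constants" unfolding assms using \<Phi>_in_constants by blast
  ultimately show ?thesis
    using \<Omega>_nth_less lead by (intro conjI exI[of _ y]) auto
qed

end
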